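(* Let $\mathcal{G}=(\mathcal{N},\mathcal{X}=\prod_{i=1}^N\mathbb{R}^{n_i},\{u_i\}_{i=1}^N)$ be a $\lambda$-cocoercive continuous game ($\lambda>0$) whose set of Nash equilibria $\mathcal{X}^*$ is nonempty. Let $(\mathbf{x}_t)_{t\ge0}$ be the noisy online gradient descent iterates $\mathbf{x}_{t+1}=\mathbf{x}_t+\eta_{t+1}(\mathbf{v}(\mathbf{x}_t)+\xi_{t+1})$ with relative random noise, i.e. $\mathbb{E}[\xi_{t+1}\mid\mathcal{F}_t]=0$ and $\mathbb{E}[\|\xi_{t+1}\|^2\mid\mathcal{F}_t]\le\tau_t\|\mathbf{v}(\mathbf{x}_t)\|^2$ for all $t\ge0$, where $\tau_t\in(0,\tau]$ for some $\tau<+\infty$. Suppose the step-size sequence satisfies $0<\underline{\eta}\le\eta_t\le\overline{\eta}<\lambda/(1+\tau)$ for all $t\ge1$. Then $$\frac{1}{T+1}\,\mathbb{E}\left[\sum_{t=0}^T\epsilon(\mathbf{x}_t)\right]=O(1/T)\quad\text{as }T\to\infty.$$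
   Context: A continuous game $\mathcal{G}=(\mathcal{N},\mathcal{X}=\prod_{i=1}^N\mathcal{X}_i,\{u_i\}_{i=1}^N)$ consists of a finite set of players $\mathcal{N}=\{1,\dots,N\}$, action sets $\mathcal{X}_i$ (here $\mathcal{X}_i=\mathbb{R}^{n_i}$), and payoff functions $u_i:\mathcal{X}\to\mathbb{R}$ such that each $u_i$ is continuous in $\mathbf{x}$, continuously differentiable in $x_i$, and the partial gradient $\nabla_{x_i}u_i(\mathbf{x})$ is Lipschitz continuous in $\mathbf{x}$. Write $v_i(\mathbf{x})=\nabla_{x_i}u_i(\mathbf{x})$ and $\mathbf{v}(\mathbf{x})=(v_1(\mathbf{x}),\dots,v_N(\mathbf{x}))$. A point $\mathbf{x}^*\in\mathcal{X}$ is a Nash equilibrium if for every $i$, $u_i(x_i^*,\mathbf{x}_{-i}^* )\ge u_i(x_i,\mathbf{x}_{-i}^* )$ for all $x_i\in\mathcal{X}_i$, where $\mathbf{x}_{-i}$ denotes the joint action of all players except $i$. The game is $\lambda$-cocoercive if $(\mathbf{x}'-\mathbf{x})^\top(\mathbf{v}(\mathbf{x}')-\mathbf{v}(\mathbf{x}))\le-\lambda\|\mathbf{v}(\mathbf{x}')-\mathbf{v}(\mathbf{x})\|^2$ for all $\mathbf{x},\mathbf{x}'\in\mathcal{X}$. The norm $\|\cdot\|$ is Euclidean, and $\epsilon(\mathbf{x})=\|\mathbf{v}(\mathbf{x})\|^2$. The initial point $\mathbf{x}_0$ is arbitrary (deterministic). The noise $(\xi_t)_{t\ge1}$ is an $L^2$-bounded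 martingale difference sequence adapted to the history $(\mathcal{F}_t)$ of the iterates ($\mathbf{x}_t$ and $\xi_t$ are $\mathcal{F}_t$-measurable). The step-sizes $\eta_t>0$ form a deterministic nonincreasing sequence, and the $\tau_t$ are deterministic. *)

theory Defs
  imports
    "HOL-Analysis.Analysis"
    "HOL-Probability.Probability"
    "HOL-Library.Landau_Symbols"
begin

text \<open>
  Players form a finite type \<open>'p\<close>. The joint action space, the product over the players \<open>i\<close> of
  the spaces of dimension \<open>n\<^sub>i\<close>, is represented as \<open>real ^ 'n\<close>, where the map \<open>pl :: 'n \<Rightarrow> 'p\<close>
  assigns to every coordinate the player controlling it. Thus \<open>n\<^sub>i = card {k. pl k = i}\<close>, the
  dimensions may differ between players, and the norm and inner product of \<open>real ^ 'n\<close> are the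
  Euclidean ones on the product. The action of player \<open>i\<close> is the block of coordinates \<open>k\<close> with
  \<open>pl k = i\<close>; a vector attached to player \<open>i\<close> is embedded in \<open>real ^ 'n\<close> by zeros elsewhere.
\<close>

text \<open>The joint action \<open>(y\<^sub>i, x\<^sub>-\<^sub>i)\<close>; it depends on \<open>y\<close> only through the block \<open>y\<^sub>i\<close>.\<close>

definition deviate :: "('n::finite \<Rightarrow> 'p) \<Rightarrow> 'p \<Rightarrow> real ^ 'n \<Rightarrow> real ^ 'n \<Rightarrow> real ^ 'n" where
  "deviate pl i y x = (\<chi> k. if pl k = i then y $ k else x $ k)"

text \<open>
  The gradient at \<open>y = x\<close> of \<open>y \<mapsto> f (y\<^sub>i, x\<^sub>-\<^sub>i)\<close>. As this function does not depend on the
  other blocks of \<open>y\<close>, this is the gradient with respect to \<open>x\<^sub>i\<close>, with zeros in the other blocks.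
\<close>

definition partial_gradient ::
    "('n::finite \<Rightarrow> 'p) \<Rightarrow> 'p \<Rightarrow> (real ^ 'n \<Rightarrow> real) \<Rightarrow> real ^ 'n \<Rightarrow> real ^ 'n" where
  "partial_gradient pl i f x = (THE g. GDERIV (\<lambda>y. f (deviate pl i y x)) x :> g)"

definition game_gradient ::
    "('n::finite \<Rightarrow> 'p) \<Rightarrow> ('p \<Rightarrow> real ^ 'n \<Rightarrow> real) \<Rightarrow> real ^ 'n \<Rightarrow> real ^ 'n" where
  "game_gradient pl u x = (\<chi> k. partial_gradient pl (pl k) (u (pl k)) x $ k)"

text \<open>
  In the third conjunct, the gradient of \<open>y \<mapsto> u\<^sub>i (y\<^sub>i, x\<^sub>-\<^sub>i)\<close> at \<open>y\<close> is the partial gradient at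
  the joint action \<open>(y\<^sub>i, x\<^sub>-\<^sub>i)\<close>.
\<close>

definition continuous_game ::
    "('n::finite \<Rightarrow> 'p) \<Rightarrow> ('p \<Rightarrow> real ^ 'n \<Rightarrow> real) \<Rightarrow> bool" where
  "continuous_game pl u \<longleftrightarrow>
    (\<forall>i. continuous_on UNIV (u i) \<and>
         (\<forall>x. (\<lambda>y. u i (deviate pl i y x)) differentiable_on UNIV) \<and>
         (\<forall>x. continuous_on UNIV (\<lambda>y. partial_gradient pl i (u i) (deviate pl i y x))) \<and>
         (\<exists>L. L-lipschitz_on UNIV (partial_gradient pl i (u i))))"

definition nash_equilibria ::
    "('n::finite \<Rightarrow> 'p) \<Rightarrow> ('p \<Rightarrow> real ^ 'n \<Rightarrow> real) \<Rightarrow> (real ^ 'n) set" where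
  "nash_equilibria pl u = {x. \<forall>i y. u i x \<ge> u i (deviate pl i y x)}"

definition cocoercive_game ::
    "real \<Rightarrow> ('n::finite \<Rightarrow> 'p) \<Rightarrow> ('p \<Rightarrow> real ^ 'n \<Rightarrow> real) \<Rightarrow> bool" where
  "cocoercive_game lam pl u \<longleftrightarrow>
    (\<forall>x x'. (x' - x) \<bullet> (game_gradient pl u x' - game_gradient pl u x)
            \<le> - lam * (norm (game_gradient pl u x' - game_gradient pl u x))\<^sup>2)"

definition gradient_residual ::
    "('n::finite \<Rightarrow> 'p) \<Rightarrow> ('p \<Rightarrow> real ^ 'n \<Rightarrow> real) \<Rightarrow> real ^ 'n \<Rightarrow> real" where
  "gradient_residual pl u x = (norm (game_gradient pl u x))\<^sup>2"

text \<open>Conditional expectation of a random vector, taken coordinatewise.\<close>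

definition vec_cond_exp ::
    "'w measure \<Rightarrow> 'w measure \<Rightarrow> ('w \<Rightarrow> real ^ 'n) \<Rightarrow> 'w \<Rightarrow> real ^ ('n::finite)" where
  "vec_cond_exp M F X w = (\<chi> k. real_cond_exp M F (\<lambda>w. X w $ k) w)"

text \<open>The THE in the definition of \<open>partial_gradient\<close> picks the gradient whenever there is one.\<close>

lemma partial_gradient_eqI:
  assumes "GDERIV (\<lambda>y. f (deviate pl i y x)) x :> g"
  shows "partial_gradient pl i f x = g"
  unfolding partial_gradient_def
proof (rule the_equality[where P = "\<lambda>g. GDERIV (\<lambda>y. f (deviate pl i y x)) x :> g", OF assms])
  fix g' assume "GDERIV (\<lambda>y. f (deviate pl i y x)) x :> g'"
  then have "(\<lambda>h. h \<bullet> g') = (\<lambda>h. h \<bullet> g)"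
    using assms unfolding gderiv_def by (rule has_derivative_unique)
  then have "\<forall>h. h \<bullet> g' = h \<bullet> g" by meson
  then show "g' = g" by (simp add: vector_eq_ldot)
qed

end

theory Submission
  imports Defs
begin

text \<open>
  Fix a Nash equilibrium \<open>z\<close>; it is a zero of the game gradient \<open>v\<close>. Expanding the squared
  distance to \<open>z\<close> and taking expectations, the noise contributes only \<open>\<eta>\<^sup>2 \<tau> E \<parallel>v(x\<^sub>t)\<parallel>\<^sup>2\<close>, while
  cocoercivity contributes \<open>-2 \<eta> \<lambda> E \<parallel>v(x\<^sub>t)\<parallel>\<^sup>2\<close>. As \<open>\<eta> (1 + \<tau>) \<le> \<lambda>\<close>, each step decreases the
  expected squared distance by at least \<open>\<eta> \<lambda> E \<parallel>v(x\<^sub>t)\<parallel>\<^sup>2\<close>, and telescoping bounds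
  \<open>\<Sum> E \<parallel>v(x\<^sub>t)\<parallel>\<^sup>2\<close> uniformly in the horizon.
\<close>

section \<open>Equilibria and regularity of the game gradient\<close>

lemma deviate_self: "deviate pl i x x = x"
  by (simp add: deviate_def vec_eq_iff)

text \<open>Fermat's rule, player by player: at an equilibrium \<open>z\<close> the map
  \<open>y \<mapsto> u i (deviate pl i y z)\<close> has a global maximum at \<open>z\<close>, and
  the action sets are unconstrained.\<close>

lemma game_gradient_nash:
  assumes game: "continuous_game pl u" and z: "z \<in> nash_equilibria pl u"
  shows "game_gradient pl u z = 0"
proof -
  have "partial_gradient pl i (u i) z = 0" for i
  proof (rule partial_gradient_eqI)
    have "(\<lambda>y. u i (deviate pl i y z)) differentiable (at z)"
      using game by (auto simp: continuous_game_def differentiable_on_def)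
    then obtain D where D: "((\<lambda>y. u i (deviate pl i y z)) has_derivative D) (at z)"
      by (auto simp: differentiable_def)
    have "D = (\<lambda>v. 0)"
      by (rule differential_zero_maxmin[OF _ open_UNIV D])
         (use z in \<open>auto simp: nash_equilibria_def deviate_self\<close>)
    then show "GDERIV (\<lambda>y. u i (deviate pl i y z)) z :> 0"
      using D by (simp add: gderiv_def)
  qed
  then show ?thesis by (simp add: game_gradient_def vec_eq_iff)
qed

text \<open>Cauchy-Schwarz applied to cocoercivity, then cancellation of one factor
  \<open>norm ?d\<close>. It provides the measurability and linear growth of the game gradient along
  the iterates.\<close>

lemma cocoercive_game_lipschitz:
  assumes "lam > 0" "cocoercive_game lam pl u"
  shows "(1 / lam)-lipschitz_on UNIV (game_gradient pl u)"
proof (rule lipschitz_onI)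
  fix x y :: "real ^ 'a"
  let ?d = "game_gradient pl u x - game_gradient pl u y"
  have "(x - y) \<bullet> ?d \<le> - lam * (norm ?d)\<^sup>2"
    using assms(2) by (auto simp: cocoercive_game_def)
  moreover have "- (norm (x - y) * norm ?d) \<le> (x - y) \<bullet> ?d"
    using Cauchy_Schwarz_ineq2[of "x - y" ?d] by linarith
  ultimately have "(lam * norm ?d) * norm ?d \<le> norm (x - y) * norm ?d"
    by (simp add: power2_eq_square algebra_simps)
  then have "lam * norm ?d \<le> norm (x - y)"
    by (cases "norm ?d = 0") (auto simp: mult_le_cancel_right)
  then show "dist (game_gradient pl u x) (game_gradient pl u y) \<le> 1 / lam * dist x y"
    using assms(1) by (simp add: dist_norm field_simps)
qed (use assms in simp)

section \<open>Square-integrable random vectors and orthogonality of the noise\<close>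

text \<open>Cauchy-Schwarz and \<open>2ab \<le> a\<^sup>2 + b\<^sup>2\<close> dominate the inner
  product by the sum of the squared norms.\<close>

lemma integrable_inner_square_integrable:
  fixes f g :: "'w \<Rightarrow> 'b::euclidean_space"
  assumes [measurable]: "f \<in> borel_measurable M" "g \<in> borel_measurable M"
    and "integrable M (\<lambda>w. (norm (f w))\<^sup>2)" "integrable M (\<lambda>w. (norm (g w))\<^sup>2)"
  shows "integrable M (\<lambda>w. f w \<bullet> g w)"
proof (rule Bochner_Integration.integrable_bound)
  show "integrable M (\<lambda>w. (norm (f w))\<^sup>2 + (norm (g w))\<^sup>2)"
    using assms by simp
  have "norm (f w \<bullet> g w) \<le> norm ((norm (f w))\<^sup>2 + (norm (g w))\<^sup>2)" for w
  proof -
    have "2 * (norm (f w) * norm (g w)) \<le> (norm (f w))\<^sup>2 + (norm (g w))\<^sup>2"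
      using sum_squares_bound[of "norm (f w)" "norm (g w)"] by simp
    moreover have "\<bar>f w \<bullet> g w\<bar> \<le> norm (f w) * norm (g w)"
      by (rule Cauchy_Schwarz_ineq2)
    moreover have "0 \<le> norm (f w) * norm (g w)" by simp
    ultimately show ?thesis by simp
  qed
  then show "AE w in M. norm (f w \<bullet> g w) \<le> norm ((norm (f w))\<^sup>2 + (norm (g w))\<^sup>2)"
    by simp
qed simp

lemma square_integrable_add:
  fixes f g :: "'w \<Rightarrow> 'b::euclidean_space"
  assumes "f \<in> borel_measurable M" "g \<in> borel_measurable M"
    and "integrable M (\<lambda>w. (norm (f w))\<^sup>2)" "integrable M (\<lambda>w. (norm (g w))\<^sup>2)"
  shows "integrable M (\<lambda>w. (norm (f w + g w))\<^sup>2)"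
proof -
  have "(\<lambda>w. (norm (f w + g w))\<^sup>2) = (\<lambda>w. (norm (f w))\<^sup>2 + 2 * (f w \<bullet> g w) + (norm (g w))\<^sup>2)"
    by (simp add: power2_norm_eq_inner algebra_simps inner_commute)
  then show ?thesis
    using assms integrable_inner_square_integrable[OF assms] by simp
qed

lemma square_integrable_scaleR:
  fixes f :: "'w \<Rightarrow> 'b::euclidean_space"
  assumes "integrable M (\<lambda>w. (norm (f w))\<^sup>2)"
  shows "integrable M (\<lambda>w. (norm (c *\<^sub>R f w))\<^sup>2)"
  using assms by (simp add: power_mult_distrib)

lemma square_integrable_mono:
  fixes f :: "'w \<Rightarrow> 'b::euclidean_space" and g :: "'w \<Rightarrow> 'c::euclidean_space"
  assumes g: "integrable M (\<lambda>w. (norm (g w))\<^sup>2)" and [measurable]: "f \<in> borel_measurable M"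
    and le: "\<And>w. norm (f w) \<le> c * norm (g w)"
  shows "integrable M (\<lambda>w. (norm (f w))\<^sup>2)"
proof (rule Bochner_Integration.integrable_bound)
  show "integrable M (\<lambda>w. c\<^sup>2 * (norm (g w))\<^sup>2)" using g by simp
  have "(norm (f w))\<^sup>2 \<le> (c * norm (g w))\<^sup>2" for w
    using le by (rule power_mono) simp
  then show "AE w in M. norm ((norm (f w))\<^sup>2) \<le> norm (c\<^sup>2 * (norm (g w))\<^sup>2)"
    by (simp add: power_mult_distrib)
qed simp

text \<open>Being \<open>F\<close>-measurable, \<open>g\<close> can be pulled out of the conditional
  expectation given \<open>F\<close>, which vanishes. The argument runs coordinate by coordinate,
  matching \<open>vec_cond_exp\<close>.\<close>

lemma integral_inner_martingale_difference:
  fixes g xi :: "'w \<Rightarrow> real ^ 'n::finite"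
  assumes "prob_space M" and sub: "subalgebra M F"
    and gF: "g \<in> borel_measurable F" and xiM: "xi \<in> borel_measurable M"
    and g2: "integrable M (\<lambda>w. (norm (g w))\<^sup>2)" and xi2: "integrable M (\<lambda>w. (norm (xi w))\<^sup>2)"
    and mean: "AE w in M. vec_cond_exp M F xi w = 0"
  shows "integral\<^sup>L M (\<lambda>w. g w \<bullet> xi w) = 0"
proof -
  interpret prob_space M by fact
  interpret finite_measure_subalgebra M F using sub by unfold_locales
  note [measurable] = gF xiM measurable_from_subalg[OF sub gF]
  have nth [measurable]: "(\<lambda>y :: real ^ 'n. y $ k) \<in> borel_measurable borel" for k
    by (intro borel_measurable_continuous_onI continuous_intros)
  have int: "integrable M (\<lambda>w. g w $ k * xi w $ k)" for k
  proof -
    have "integrable M (\<lambda>w. (norm (g w $ k))\<^sup>2)"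
      by (rule square_integrable_mono[where c = 1, OF g2]) (simp_all add: component_le_norm_cart)
    moreover have "integrable M (\<lambda>w. (norm (xi w $ k))\<^sup>2)"
      by (rule square_integrable_mono[where c = 1, OF xi2]) (simp_all add: component_le_norm_cart)
    ultimately show ?thesis
      using integrable_inner_square_integrable[of "\<lambda>w. g w $ k" M "\<lambda>w. xi w $ k"] by simp
  qed
  have "integral\<^sup>L M (\<lambda>w. g w $ k * xi w $ k) = 0" for k
  proof -
    have "integral\<^sup>L M (\<lambda>w. g w $ k * xi w $ k)
        = integral\<^sup>L M (\<lambda>w. g w $ k * real_cond_exp M F (\<lambda>w. xi w $ k) w)"
      using int by (intro real_cond_exp_intg(2)[symmetric]) simp_all
    also have "\<dots> = integral\<^sup>L M (\<lambda>w. 0)"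
    proof (rule integral_cong_AE)
      show "AE w in M. g w $ k * real_cond_exp M F (\<lambda>w. xi w $ k) w = 0"
        using mean by eventually_elim (simp add: vec_cond_exp_def vec_eq_iff)
    qed simp_all
    finally show ?thesis by simp
  qed
  then show ?thesis
    using int by (simp add: inner_vec_def)
qed

section \<open>Expected decrease in one step\<close>

text \<open>Square-integrability of \<open>X - z\<close> is assumed here and recovered for the
  updated point, so the lemma can be iterated along the trajectory.\<close>

lemma expected_descent:
  fixes v :: "real ^ 'n::finite \<Rightarrow> real ^ 'n" and X xi :: "'w \<Rightarrow> real ^ 'n"
  assumes prob: "prob_space M" and sub: "subalgebra M F"
    and lip: "L-lipschitz_on UNIV v" and vz: "v z = 0"
    and coc: "\<And>x. (x - z) \<bullet> v x \<le> - lam * (norm (v x))\<^sup>2"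
    and XF: "X \<in> borel_measurable F" and xiM: "xi \<in> borel_measurable M"
    and X2: "integrable M (\<lambda>w. (norm (X w - z))\<^sup>2)"
    and xi2: "integrable M (\<lambda>w. (norm (xi w))\<^sup>2)"
    and mean: "AE w in M. vec_cond_exp M F xi w = 0"
    and rel: "AE w in M. real_cond_exp M F (\<lambda>w. (norm (xi w))\<^sup>2) w \<le> tau * (norm (v (X w)))\<^sup>2"
    and eta: "0 \<le> eta" "eta * (1 + tau) \<le> lam"
  shows "integrable M (\<lambda>w. (norm (v (X w)))\<^sup>2)" (is ?V)
    and "integrable M (\<lambda>w. (norm (X w + eta *\<^sub>R (v (X w) + xi w) - z))\<^sup>2)" (is ?I)
    and "integral\<^sup>L M (\<lambda>w. (norm (X w + eta *\<^sub>R (v (X w) + xi w) - z))\<^sup>2)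
      \<le> integral\<^sup>L M (\<lambda>w. (norm (X w - z))\<^sup>2) - eta * lam * integral\<^sup>L M (\<lambda>w. (norm (v (X w)))\<^sup>2)"
      (is ?D)
proof -
  interpret prob_space M by fact
  interpret finite_measure_subalgebra M F using sub by unfold_locales
  have "continuous_on UNIV v" using lip by (rule lipschitz_on_continuous_on)
  then have [measurable]: "v \<in> borel_measurable borel" by (rule borel_measurable_continuous_onI)
  note [measurable] = XF xiM measurable_from_subalg[OF sub XF]
  \<comment> \<open>Since \<open>v z = 0\<close>, the Lipschitz bound becomes linear growth away
    from \<open>z\<close>.\<close>
  have "norm (v (X w)) \<le> L * norm (X w - z)" for w
    using lipschitz_onD[OF lip, of "X w" z] vz by (simp add: dist_norm)
  from square_integrable_mono[OF X2 _ this] show v2: ?V by simp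
  \<comment> \<open>\<open>g\<close> collects everything paired with \<open>xi\<close> when the
    square is expanded: the cross terms with \<open>X - z\<close> and with \<open>v (X w)\<close>.
    It depends only on \<open>X\<close>, so it is \<open>F\<close>-measurable.\<close>
  define g where "g w = (2 * eta) *\<^sub>R (X w - z) + (2 * eta\<^sup>2) *\<^sub>R v (X w)" for w
  have gF [measurable]: "g \<in> borel_measurable F" unfolding g_def by measurable
  have gM [measurable]: "g \<in> borel_measurable M" by (rule measurable_from_subalg[OF sub gF])
  have g2: "integrable M (\<lambda>w. (norm (g w))\<^sup>2)"
    unfolding g_def by (intro square_integrable_add square_integrable_scaleR X2 v2; measurable)
  have cross: "integral\<^sup>L M (\<lambda>w. g w \<bullet> xi w) = 0"
    by (rule integral_inner_martingale_difference[OF prob sub gF xiM g2 xi2 mean])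
  have gxi: "integrable M (\<lambda>w. g w \<bullet> xi w)"
    by (rule integrable_inner_square_integrable[OF gM xiM g2 xi2])
  have Xv: "integrable M (\<lambda>w. (X w - z) \<bullet> v (X w))"
    by (rule integrable_inner_square_integrable[OF _ _ X2 v2]) measurable
  have expand: "(\<lambda>w. (norm (X w + eta *\<^sub>R (v (X w) + xi w) - z))\<^sup>2) =
      (\<lambda>w. (norm (X w - z))\<^sup>2 + 2 * eta * ((X w - z) \<bullet> v (X w)) + eta\<^sup>2 * (norm (v (X w)))\<^sup>2
        + eta\<^sup>2 * (norm (xi w))\<^sup>2 + g w \<bullet> xi w)"
    unfolding g_def power2_norm_eq_inner unfolding power2_eq_square
    by (simp add: fun_eq_iff inner_add_left inner_add_right inner_diff_left inner_diff_right
        inner_commute algebra_simps)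
  show ?I
    unfolding expand using X2 v2 xi2 gxi Xv by simp
  have noise: "integral\<^sup>L M (\<lambda>w. (norm (xi w))\<^sup>2) \<le> tau * integral\<^sup>L M (\<lambda>w. (norm (v (X w)))\<^sup>2)"
  proof -
    \<comment> \<open>By the tower property, integrating the conditional bound gives the
      unconditional one.\<close>
    have "integral\<^sup>L M (\<lambda>w. (norm (xi w))\<^sup>2)
        = integral\<^sup>L M (real_cond_exp M F (\<lambda>w. (norm (xi w))\<^sup>2))"
      by (rule real_cond_exp_int(2)[OF xi2, symmetric])
    also have "\<dots> \<le> integral\<^sup>L M (\<lambda>w. tau * (norm (v (X w)))\<^sup>2)"
      using rel v2 by (intro integral_mono_AE real_cond_exp_int(1)[OF xi2]) simp_all
    finally show ?thesis by simp
  qed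
  have drift: "integral\<^sup>L M (\<lambda>w. (X w - z) \<bullet> v (X w))
      \<le> - lam * integral\<^sup>L M (\<lambda>w. (norm (v (X w)))\<^sup>2)"
  proof -
    have "integral\<^sup>L M (\<lambda>w. (X w - z) \<bullet> v (X w)) \<le> integral\<^sup>L M (\<lambda>w. - lam * (norm (v (X w)))\<^sup>2)"
      using Xv v2 coc by (intro integral_mono) simp_all
    then show ?thesis by simp
  qed
  let ?A = "integral\<^sup>L M (\<lambda>w. (norm (X w - z))\<^sup>2)"
  let ?B = "integral\<^sup>L M (\<lambda>w. (norm (v (X w)))\<^sup>2)"
  let ?C = "integral\<^sup>L M (\<lambda>w. (norm (xi w))\<^sup>2)"
  let ?E = "integral\<^sup>L M (\<lambda>w. (X w - z) \<bullet> v (X w))"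
  have "integral\<^sup>L M (\<lambda>w. (norm (X w + eta *\<^sub>R (v (X w) + xi w) - z))\<^sup>2)
      = ?A + 2 * eta * ?E + eta\<^sup>2 * ?B + eta\<^sup>2 * ?C"
    unfolding expand using X2 v2 xi2 gxi Xv cross by simp
  also have "\<dots> \<le> ?A + 2 * eta * (- lam * ?B) + eta\<^sup>2 * ?B + eta\<^sup>2 * (tau * ?B)"
    using noise drift eta by (intro add_mono mult_left_mono) simp_all
  \<comment> \<open>Isolating \<open>eta * (1 + tau)\<close> lets the step-size condition replace it
    by \<open>lam\<close>: the quadratic terms consume at most half of the drift
    \<open>2 * eta * lam * ?B\<close>.\<close>
  also have "\<dots> = ?A - 2 * eta * lam * ?B + (eta * ?B) * (eta * (1 + tau))"
    by (simp add: algebra_simps power2_eq_square)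
  also have "\<dots> \<le> ?A - 2 * eta * lam * ?B + (eta * ?B) * lam"
    using eta by (intro add_mono order_refl mult_left_mono) simp_all
  also have "\<dots> = ?A - eta * lam * ?B" by (simp add: algebra_simps)
  finally show ?D .
qed

section \<open>Summation over the steps and the rate\<close>

theorem theorem4p4:
  fixes pl :: "'n::finite \<Rightarrow> 'p::finite"
    and u :: "'p \<Rightarrow> real ^ 'n \<Rightarrow> real"
    and lam tau eta_lo eta_hi :: real
    and M :: "'w measure"
    and F :: "nat \<Rightarrow> 'w measure"
    and x0 :: "real ^ 'n"
    and x xi :: "nat \<Rightarrow> 'w \<Rightarrow> real ^ 'n"
    and eta taus :: "nat \<Rightarrow> real"
  assumes game: "continuous_game pl u"
    and lam_pos: "lam > 0"
    and cocoercive: "cocoercive_game lam pl u"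
    and nash: "nash_equilibria pl u \<noteq> {}"
    and prob: "prob_space M"
    and filtration: "filtration (space M) F"
    and subalg: "\<And>t. subalgebra M (F t)"
    and x_adapted: "\<And>t. x t \<in> borel_measurable (F t)"
    and xi_adapted: "\<And>t. t \<ge> 1 \<Longrightarrow> xi t \<in> borel_measurable (F t)"
    and xi_L2: "\<exists>C. \<forall>t\<ge>1. integrable M (\<lambda>w. (norm (xi t w))\<^sup>2)
                        \<and> integral\<^sup>L M (\<lambda>w. (norm (xi t w))\<^sup>2) \<le> C"
    and xi_mean: "\<And>t. AE w in M. vec_cond_exp M (F t) (xi (Suc t)) w = 0"
    and xi_rel: "\<And>t. AE w in M. real_cond_exp M (F t) (\<lambda>w. (norm (xi (Suc t) w))\<^sup>2) w
                        \<le> taus t * (norm (game_gradient pl u (x t w)))\<^sup>2"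
    and taus: "\<And>t. 0 < taus t \<and> taus t \<le> tau"
    and init: "\<And>w. w \<in> space M \<Longrightarrow> x 0 w = x0"
    and iter: "\<And>t w. w \<in> space M \<Longrightarrow>
        x (Suc t) w = x t w + eta (Suc t) *\<^sub>R (game_gradient pl u (x t w) + xi (Suc t) w)"
    and eta_noninc: "\<And>t. t \<ge> 1 \<Longrightarrow> eta (Suc t) \<le> eta t"
    and eta_lo_pos: "0 < eta_lo"
    and eta_bounds: "\<And>t. t \<ge> 1 \<Longrightarrow> eta_lo \<le> eta t \<and> eta t \<le> eta_hi"
    and eta_hi_less: "eta_hi < lam / (1 + tau)"
  shows "(\<forall>T. integrable M (\<lambda>w. \<Sum>t\<le>T. gradient_residual pl u (x t w))) \<and>
         (\<lambda>T. 1 / (real T + 1) *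
               integral\<^sup>L M (\<lambda>w. \<Sum>t\<le>T. gradient_residual pl u (x t w)))
           \<in> O(\<lambda>T. 1 / real T)"
proof -
  interpret prob_space M by fact
  let ?v = "game_gradient pl u"
  obtain z where z: "z \<in> nash_equilibria pl u" using nash by auto
  have vz: "?v z = 0" by (rule game_gradient_nash[OF game z])
  have coc: "(y - z) \<bullet> ?v y \<le> - lam * (norm (?v y))\<^sup>2" for y
    using cocoercive[unfolded cocoercive_game_def, rule_format, of y z] by (simp add: vz)
  \<comment> \<open>Makes \<open>1 + tau\<close> positive, so the bound on \<open>eta_hi\<close> can
    be cleared of its denominator.\<close>
  have tau_pos: "0 < tau" using taus[of 0] by linarith
  have step: "eta_lo \<le> eta (Suc t)" "0 \<le> eta (Suc t)" "eta (Suc t) * (1 + taus t) \<le> lam" for t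
  proof -
    show "eta_lo \<le> eta (Suc t)" and nn: "0 \<le> eta (Suc t)"
      using eta_bounds[of "Suc t"] eta_lo_pos by auto
    have "eta (Suc t) * (1 + taus t) \<le> eta_hi * (1 + tau)"
      using eta_bounds[of "Suc t"] nn taus[of t] by (intro mult_mono) auto
    also have "\<dots> \<le> lam"
      using eta_hi_less tau_pos by (simp add: field_simps)
    finally show "eta (Suc t) * (1 + taus t) \<le> lam" .
  qed
  have xiM: "xi (Suc t) \<in> borel_measurable M" for t
    by (rule measurable_from_subalg[OF subalg xi_adapted]) simp
  have xi2: "integrable M (\<lambda>w. (norm (xi (Suc t) w))\<^sup>2)" for t
    using xi_L2 by auto
  \<comment> \<open>The premise left open is the square-integrability of \<open>x t - z\<close>,
    which is established below by induction using the second conclusion of the descent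
    lemma.\<close>
  note descent = expected_descent[OF prob subalg cocoercive_game_lipschitz[OF lam_pos cocoercive]
      vz coc x_adapted xiM _ xi2 xi_mean xi_rel step(2,3)]
  define V where "V t = integral\<^sup>L M (\<lambda>w. (norm (x t w - z))\<^sup>2)" for t
  define R where "R t = integral\<^sup>L M (\<lambda>w. gradient_residual pl u (x t w))" for t
  have x2: "integrable M (\<lambda>w. (norm (x t w - z))\<^sup>2)" for t
  proof (induction t)
    case 0
    have "integrable M (\<lambda>w. (norm (x 0 w - z))\<^sup>2) \<longleftrightarrow> integrable M (\<lambda>w. (norm (x0 - z))\<^sup>2)"
      by (rule Bochner_Integration.integrable_cong) (simp_all add: init)
    then show ?case by simp
  next
    case (Suc t)
    show ?case
      using descent(2)[OF Suc] iter by (simp cong: Bochner_Integration.integrable_cong)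
  qed
  have res: "integrable M (\<lambda>w. gradient_residual pl u (x t w))" for t
    unfolding gradient_residual_def by (rule descent(1)[OF x2])
  have R_nonneg: "0 \<le> R t" for t by (simp add: R_def gradient_residual_def)
  have V_step: "V (Suc t) \<le> V t - eta_lo * lam * R t" for t
  proof -
    have "V (Suc t) \<le> V t - eta (Suc t) * lam * R t"
      using descent(3)[OF x2, of t] iter
      by (simp add: V_def R_def gradient_residual_def cong: Bochner_Integration.integral_cong)
    \<comment> \<open>Passing to the uniform lower bound \<open>eta_lo\<close> gives every step the
      same coefficient, so that the sum telescopes.\<close>
    moreover have "eta_lo * lam * R t \<le> eta (Suc t) * lam * R t"
      using step(1) lam_pos R_nonneg by (intro mult_right_mono) simp_all
    ultimately show ?thesis by linarith
  qed
  have telescope: "eta_lo * lam * (\<Sum>t\<le>T. R t) \<le> V 0 - V (Suc T)" for T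
  proof (induction T)
    case 0
    show ?case using V_step[of 0] by simp
  next
    case (Suc T)
    then show ?case using V_step[of "Suc T"] by (simp add: distrib_left)
  qed
  \<comment> \<open>The telescoped bound with \<open>V (Suc T) \<ge> 0\<close> dropped; it is
    independent of \<open>T\<close>.\<close>
  define C where "C = V 0 / (eta_lo * lam)"
  have bound: "(\<Sum>t\<le>T. R t) \<le> C" for T
  proof -
    have "0 \<le> V (Suc T)" by (simp add: V_def)
    then have "eta_lo * lam * (\<Sum>t\<le>T. R t) \<le> V 0" using telescope[of T] by linarith
    then show ?thesis
      using eta_lo_pos lam_pos by (simp add: C_def pos_le_divide_eq mult.commute)
  qed
  have sum_eq: "integral\<^sup>L M (\<lambda>w. \<Sum>t\<le>T. gradient_residual pl u (x t w)) = (\<Sum>t\<le>T. R t)" for T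
    using res by (simp add: R_def)
  have "(\<lambda>T. 1 / (real T + 1) * (\<Sum>t\<le>T. R t)) \<in> O(\<lambda>T. 1 / real T)"
  \<comment> \<open>\<open>T = 0\<close> is excluded because \<open>1 / real 0\<close> is
    \<open>0\<close> by convention, while the left-hand side may be positive there.\<close>
  proof (rule bigoI[where c = C], rule eventually_mono[OF eventually_gt_at_top[of 0]])
    fix T :: nat assume "T > 0"
    have nn: "0 \<le> (\<Sum>t\<le>T. R t)" by (simp add: R_nonneg sum_nonneg)
    have "1 / (real T + 1) * (\<Sum>t\<le>T. R t) \<le> 1 / real T * C"
      using \<open>T > 0\<close> nn bound by (intro mult_mono) (simp_all add: field_simps)
    then show "norm (1 / (real T + 1) * (\<Sum>t\<le>T. R t)) \<le> C * norm (1 / real T)"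
      using nn by (simp add: mult.commute)
  qed
  then show ?thesis
    using res by (simp add: sum_eq)
qed

end
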